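(* Let $K$ be a finite oriented two-dimensional cell complex, let $\mathcal V=\ker d_0^*\subset C^1(K)$ be its divergence-free edge-cochain space, and let $P:C^1(K)\to\mathcal V$ be the orthogonal projector onto $\mathcal V$. Choose an oriented edge basis, identifying $C^1(K)\simeq\mathbb R^m$ with its Euclidean inner product, fix a skew-symmetric matrix $J\in\mathbb R^{m\times m}$, and for $a\in\mathbb R^m$ let $D(a)=\operatorname{diag}(a_1,\ldots,a_m)$. Define $$M(a):=D(a)J+JD(a),\qquad B(a,b):=PM(a)b\qquad(a,b\in\mathcal V).$$ Then for all $a,b,c\in\mathcal V$: $B(a,b)\in\mathcal V$; $M(a)^\top=-M(a)$; the trilinear form $b(a,b,c):=\langle B(a,b),c\rangle$ satisfies $b(a,b,c)=-b(a,c,b)$; and $$\|B(a,b)\|\leq2\|J\|\,\|a\|\,\|b\|.$$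
   Context: $K$ is a finite oriented two-dimensional cell complex with finite-dimensional real cochain spaces $C^q(K)$, $q=0,1,2$, carrying fixed Euclidean inner products. The coboundary operator $d_0:C^0(K)\to C^1(K)$ is linear and $d_0^*$ is its adjoint. Here $m=\dim C^1(K)$ is the number of edges, the oriented edge basis is orthonormal (so the inner product of $C^1(K)$ is the standard one of $\mathbb R^m$), $\|\cdot\|$ on vectors is the Euclidean norm, and $\|J\|$ is the operator norm induced by it. *)

theory Defs
  imports "HOL-Analysis.Analysis"
begin

text \<open>
  Cells are indexed by finite types: \<open>'v\<close> (vertices), \<open>'e\<close> (edges), \<open>'f\<close> (faces), and
  \<open>C\<^sup>0(K)\<close>, \<open>C\<^sup>1(K)\<close>, \<open>C\<^sup>2(K)\<close> are \<open>real^'v\<close>, \<open>real^'e\<close>, \<open>real^'f\<close>.  An oriented edge \<open>e\<close> runs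
  from \<open>tail e\<close> to \<open>head e\<close> (loops and multiple edges are allowed).  An oriented face is attached
  along a closed edge path, given as a list of edges with a flag that is \<open>True\<close> iff the edge is
  traversed along its orientation; the empty path attaches the face at a single vertex.
\<close>

definition step_source :: "('e \<Rightarrow> 'v) \<Rightarrow> ('e \<Rightarrow> 'v) \<Rightarrow> 'e \<times> bool \<Rightarrow> 'v" where
  "step_source tail head s = (if snd s then tail (fst s) else head (fst s))"

definition step_target :: "('e \<Rightarrow> 'v) \<Rightarrow> ('e \<Rightarrow> 'v) \<Rightarrow> 'e \<times> bool \<Rightarrow> 'v" where
  "step_target tail head s = (if snd s then head (fst s) else tail (fst s))"

fun edge_path :: "('e \<Rightarrow> 'v) \<Rightarrow> ('e \<Rightarrow> 'v) \<Rightarrow> 'v \<Rightarrow> ('e \<times> bool) list \<Rightarrow> 'v \<Rightarrow> bool" where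
  "edge_path tail head u [] w \<longleftrightarrow> u = w"
| "edge_path tail head u (s # p) w \<longleftrightarrow>
     step_source tail head s = u \<and> edge_path tail head (step_target tail head s) p w"

definition oriented_cell_complex2 ::
    "('e::finite \<Rightarrow> 'v::finite) \<Rightarrow> ('e \<Rightarrow> 'v) \<Rightarrow> ('f::finite \<Rightarrow> ('e \<times> bool) list) \<Rightarrow> bool" where
  "oriented_cell_complex2 tail head attach \<longleftrightarrow>
     (\<forall>\<sigma>. \<exists>u. edge_path tail head u (attach \<sigma>) u)"

definition coboundary0 ::
    "('e::finite \<Rightarrow> 'v::finite) \<Rightarrow> ('e \<Rightarrow> 'v) \<Rightarrow> real^'v \<Rightarrow> real^'e" where
  "coboundary0 tail head \<phi> = (\<chi> e. \<phi> $ head e - \<phi> $ tail e)"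

definition coboundary1 :: "('f::finite \<Rightarrow> ('e::finite \<times> bool) list) \<Rightarrow> real^'e \<Rightarrow> real^'f" where
  "coboundary1 attach a =
     (\<chi> \<sigma>. \<Sum>s\<leftarrow>attach \<sigma>. if snd s then a $ fst s else - (a $ fst s))"

lemma coboundary0_edge_path:
  assumes "edge_path tail head u p w"
  shows "(\<Sum>s\<leftarrow>p. if snd s then coboundary0 tail head \<phi> $ fst s
                    else - (coboundary0 tail head \<phi> $ fst s)) = \<phi> $ w - \<phi> $ u"
  using assms
  by (induction p arbitrary: u)
     (auto simp: coboundary0_def step_source_def step_target_def split: if_splits)

lemma coboundary1_coboundary0:
  assumes "oriented_cell_complex2 tail head attach"
  shows "coboundary1 attach (coboundary0 tail head \<phi>) = 0"
proof -
  have "coboundary1 attach (coboundary0 tail head \<phi>) $ \<sigma> = 0" for \<sigma>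
  proof -
    obtain u where "edge_path tail head u (attach \<sigma>) u"
      using assms by (auto simp: oriented_cell_complex2_def)
    from coboundary0_edge_path[OF this, of \<phi>] show ?thesis
      by (simp add: coboundary1_def)
  qed
  then show ?thesis by (simp add: vec_eq_iff)
qed

definition is_inner_product :: "('a::real_vector \<Rightarrow> 'a \<Rightarrow> real) \<Rightarrow> bool" where
  "is_inner_product ip \<longleftrightarrow>
     bilinear ip \<and> (\<forall>x y. ip x y = ip y x) \<and> (\<forall>x. x \<noteq> 0 \<longrightarrow> ip x x > 0)"

text \<open>
  The inner product of \<open>C\<^sup>0(K)\<close> is an arbitrary one, \<open>ip0\<close>; that of \<open>C\<^sup>1(K)\<close> is the standard one of
  \<open>real^'e\<close>, for which the edge basis is orthonormal.  The library's \<open>adjoint\<close> refers to the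
  standard inner products on both sides and so does not apply here.
\<close>

definition coboundary0_adjoint ::
    "('e::finite \<Rightarrow> 'v::finite) \<Rightarrow> ('e \<Rightarrow> 'v) \<Rightarrow> (real^'v \<Rightarrow> real^'v \<Rightarrow> real) \<Rightarrow> real^'e \<Rightarrow> real^'v" where
  "coboundary0_adjoint tail head ip0 =
     (THE g. \<forall>\<phi> a. coboundary0 tail head \<phi> \<bullet> a = ip0 \<phi> (g a))"

lemma coboundary0_adjoint_works:
  fixes tail head :: "'e::finite \<Rightarrow> 'v::finite"
  assumes "is_inner_product ip0"
  shows "coboundary0 tail head \<phi> \<bullet> a = ip0 \<phi> (coboundary0_adjoint tail head ip0 a)"
proof -
  let ?d = "coboundary0 tail head"
  have bil: "bilinear ip0" and pos: "\<And>x. x \<noteq> 0 \<Longrightarrow> ip0 x x > 0"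
    using assms by (auto simp: is_inner_product_def)
  have linl: "linear (\<lambda>x. ip0 x y)" and linr: "linear (ip0 y)" for y
    using bil by (auto simp: bilinear_def)
  have lind: "linear (\<lambda>\<phi>. ?d \<phi> \<bullet> a)" for a
    by (intro linearI)
       (auto simp: coboundary0_def inner_vec_def sum_distrib_left simp flip: sum.distrib
             intro!: sum.cong simp: algebra_simps)
  define T where "T g = (\<chi> v. ip0 (axis v 1) g)" for g :: "real^'v"
  have linT: "linear T"
    by (intro linearI)
       (auto simp: T_def vec_eq_iff linear_add[OF linr] linear_scale[OF linr])
  have ext: "f = h" if "linear f" "linear h" "\<And>v. f (axis v 1) = h (axis v 1)"
    for f h :: "real^'v \<Rightarrow> real"
    using that by (intro linear_eq_stdbasis) (auto simp: Basis_vec_def)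
  have lin0: "linear (\<lambda>x::real^'v. 0::real)"
    by (intro linearI) auto
  have "inj T"
    unfolding linear_injective_0[OF linT]
  proof (intro allI impI)
    fix g assume "T g = 0"
    then have "(\<lambda>x. ip0 x g) = (\<lambda>x. 0)"
      by (intro ext linl lin0) (auto simp: T_def vec_eq_iff)
    then show "g = 0" using pos[of g] by (metis less_irrefl)
  qed
  then have "surj T" using linT by (simp add: linear_injective_imp_surjective)
  have "\<exists>g. \<forall>\<phi>. ?d \<phi> \<bullet> a = ip0 \<phi> g" for a
  proof -
    obtain g where "T g = (\<chi> v. ?d (axis v 1) \<bullet> a)"
      using \<open>surj T\<close> by (metis surjD)
    then have "(\<lambda>\<phi>. ?d \<phi> \<bullet> a) = (\<lambda>\<phi>. ip0 \<phi> g)"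
      by (intro ext linl lind) (auto simp: T_def vec_eq_iff)
    then show ?thesis by metis
  qed
  then obtain g where g: "\<forall>\<phi> a. ?d \<phi> \<bullet> a = ip0 \<phi> (g a)" by metis
  have "h = g" if h: "\<forall>\<phi> a. ?d \<phi> \<bullet> a = ip0 \<phi> (h a)" for h
  proof
    fix a
    have "ip0 (h a - g a) (h a - g a) = 0"
      using g h by (simp add: linear_diff[OF linr])
    then show "h a = g a" using pos[of "h a - g a"] by auto
  qed
  with g have "\<forall>\<phi> a. ?d \<phi> \<bullet> a = ip0 \<phi> (coboundary0_adjoint tail head ip0 a)"
    unfolding coboundary0_adjoint_def by (rule theI)
  then show ?thesis by blast
qed

definition div_free ::
    "('e::finite \<Rightarrow> 'v::finite) \<Rightarrow> ('e \<Rightarrow> 'v) \<Rightarrow> (real^'v \<Rightarrow> real^'v \<Rightarrow> real) \<Rightarrow> (real^'e) set" where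
  "div_free tail head ip0 = {a. coboundary0_adjoint tail head ip0 a = 0}"

definition orth_projector :: "'a::euclidean_space set \<Rightarrow> 'a \<Rightarrow> 'a" where
  "orth_projector V x = (THE y. y \<in> V \<and> (\<forall>z\<in>V. orthogonal (x - y) z))"

lemma orth_projector_works:
  assumes "subspace V"
  shows "orth_projector V x \<in> V \<and> (\<forall>z\<in>V. orthogonal (x - orth_projector V x) z)"
  unfolding orth_projector_def
proof (rule theI')
  obtain y z where "y \<in> span V" "\<And>w. w \<in> span V \<Longrightarrow> orthogonal z w" "x = y + z"
    using orthogonal_subspace_decomp_exists by metis
  moreover have "span V = V" using assms by simp
  ultimately have y: "y \<in> V \<and> (\<forall>w\<in>V. orthogonal (x - y) w)" by auto
  have "y' = y" if "y' \<in> V \<and> (\<forall>w\<in>V. orthogonal (x - y') w)" for y'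
  proof -
    have "y' - y \<in> V" using that y assms by (simp add: subspace_diff)
    then have "(x - y) \<bullet> (y' - y) = 0" "(x - y') \<bullet> (y' - y) = 0"
      using y that by (auto simp: orthogonal_def)
    then have "(y' - y) \<bullet> (y' - y) = 0" by (simp add: inner_diff_left)
    then show ?thesis by simp
  qed
  with y show "\<exists>!y. y \<in> V \<and> (\<forall>w\<in>V. orthogonal (x - y) w)" by blast
qed

definition diag_matrix :: "real^'n \<Rightarrow> real^'n^'n" where
  "diag_matrix a = (\<chi> i j. if i = j then a $ i else 0)"

definition adv_matrix :: "real^'n^'n \<Rightarrow> real^'n \<Rightarrow> real^'n^'n" where
  "adv_matrix J a = diag_matrix a ** J + J ** diag_matrix a"

definition adv_op :: "(real^'n) set \<Rightarrow> real^'n^'n \<Rightarrow> real^'n \<Rightarrow> real^'n \<Rightarrow> real^'n" where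
  "adv_op V J a b = orth_projector V (adv_matrix J a *v b)"

definition adv_form :: "(real^'n) set \<Rightarrow> real^'n^'n \<Rightarrow> real^'n \<Rightarrow> real^'n \<Rightarrow> real^'n \<Rightarrow> real" where
  "adv_form V J a b c = adv_op V J a b \<bullet> c"

definition trilinear_on :: "'a::real_vector set \<Rightarrow> ('a \<Rightarrow> 'a \<Rightarrow> 'a \<Rightarrow> real) \<Rightarrow> bool" where
  "trilinear_on V t \<longleftrightarrow>
     (\<forall>x\<in>V. \<forall>y\<in>V. \<forall>b\<in>V. \<forall>c\<in>V. \<forall>r s.
        t (r *\<^sub>R x + s *\<^sub>R y) b c = r * t x b c + s * t y b c \<and>
        t b (r *\<^sub>R x + s *\<^sub>R y) c = r * t b x c + s * t b y c \<and>
        t b c (r *\<^sub>R x + s *\<^sub>R y) = r * t b c x + s * t b c y)"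

end

theory Submission
  imports Defs
begin

text \<open>
  A cochain is divergence-free iff it is orthogonal to every gradient \<open>d\<^sub>0 \<phi>\<close>, so \<open>\<V>\<close> is an
  orthogonal complement and in particular a subspace.  On any subspace \<open>V\<close>, the
  projector is invisible to inner products with elements of \<open>V\<close>, hence
  \<open>b(a,b,c) = \<langle>M(a) b, c\<rangle>\<close> for \<open>c \<in> V\<close> (\<open>adv_form_eq_inner\<close>).  Trilinearity follows from this, and
  so does antisymmetry in the last two arguments, because \<open>M(a)\<close> is skew: transposition swaps the
  two terms \<open>D(a) J\<close> and \<open>J D(a)\<close> and reverses the sign of \<open>J\<close>.

  For the estimate, the Euclidean norm of \<open>a\<close> bounds all its entries, so \<open>D(a)\<close> has operator norm at
  most \<open>\<parallel>a\<parallel>\<close>; each of the two terms of \<open>M(a)\<close> then has operator norm at most \<open>\<parallel>J\<parallel> \<parallel>a\<parallel>\<close>, and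
  the projector does not increase norms.
\<close>

text \<open>
  The inner product on vertex cochains is non-degenerate, so \<open>d\<^sub>0\<^sup>* a = 0\<close> can be tested by pairing
  with all \<open>\<phi>\<close>, and each pairing is \<open>\<langle>d\<^sub>0 \<phi>, a\<rangle>\<close> by adjointness.
\<close>

lemma div_free_iff_orthogonal_gradients:
  assumes "is_inner_product ip0"
  shows "a \<in> div_free tail head ip0 \<longleftrightarrow> (\<forall>\<phi>. coboundary0 tail head \<phi> \<bullet> a = 0)"
proof -
  let ?g = "coboundary0_adjoint tail head ip0 a"
  have "ip0 \<phi> 0 = 0" for \<phi>
    using assms unfolding is_inner_product_def by (blast intro: bilinear_rzero)
  moreover have "?g \<noteq> 0 \<longrightarrow> ip0 ?g ?g > 0"
    using assms unfolding is_inner_product_def by blast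
  ultimately show ?thesis
    unfolding div_free_def mem_Collect_eq coboundary0_adjoint_works[OF assms] by (metis less_irrefl)
qed

lemma subspace_div_free:
  assumes "is_inner_product ip0"
  shows "subspace (div_free tail head ip0)"
  by (simp add: subspace_def div_free_iff_orthogonal_gradients[OF assms] inner_add_right)

lemma inner_orth_projector:
  assumes "subspace V" "c \<in> V"
  shows "orth_projector V x \<bullet> c = x \<bullet> c"
  using orth_projector_works[OF assms(1), of x] assms(2)
  by (simp add: orthogonal_def inner_diff_left)

text \<open>
  With \<open>y = P x\<close> one has \<open>\<parallel>y\<parallel>\<^sup>2 = \<langle>x, y\<rangle>\<close>, and Cauchy-Schwarz applies.
\<close>

lemma norm_orth_projector_le:
  assumes "subspace V"
  shows "norm (orth_projector V x) \<le> norm x"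
proof -
  let ?y = "orth_projector V x"
  have "?y \<in> V" using orth_projector_works[OF assms] by blast
  then have "norm ?y * norm ?y = x \<bullet> ?y"
    using inner_orth_projector[OF assms, of ?y x]
    by (simp add: power2_norm_eq_inner flip: power2_eq_square)
  also have "\<dots> \<le> norm x * norm ?y" by (rule norm_cauchy_schwarz)
  finally show ?thesis
    by (cases "?y = 0") auto
qed

lemma diag_matrix_mult_vector: "diag_matrix a *v x = (\<chi> i. a $ i * x $ i)"
  by (simp add: diag_matrix_def matrix_vector_mult_def vec_eq_iff if_distrib if_distribR
        cong: if_cong)

lemma transpose_diag_matrix: "transpose (diag_matrix a) = diag_matrix a"
  by (auto simp: diag_matrix_def transpose_def vec_eq_iff)

lemma norm_diag_matrix_mult_le: "norm (diag_matrix a *v x) \<le> norm a * norm x"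
proof -
  have "norm (diag_matrix a *v x) \<le> norm (norm a *\<^sub>R x)"
    by (rule norm_le_componentwise_cart)
       (simp add: diag_matrix_mult_vector abs_mult mult_right_mono component_le_norm_cart)
  then show ?thesis by simp
qed

lemma adv_matrix_mult_vector:
  "adv_matrix J a *v b = diag_matrix a *v (J *v b) + J *v (diag_matrix a *v b)"
  by (simp add: adv_matrix_def matrix_vector_mult_add_rdistrib matrix_vector_mul_assoc)

lemma adv_matrix_mult_lincomb_left:
  "adv_matrix J (r *\<^sub>R x + s *\<^sub>R y) *v b = r *\<^sub>R (adv_matrix J x *v b) + s *\<^sub>R (adv_matrix J y *v b)"
proof -
  have "diag_matrix (r *\<^sub>R x + s *\<^sub>R y) *v z = r *\<^sub>R (diag_matrix x *v z) + s *\<^sub>R (diag_matrix y *v z)"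
    for z
    by (simp add: diag_matrix_mult_vector vec_eq_iff algebra_simps)
  then show ?thesis
    by (simp add: adv_matrix_mult_vector matrix_vector_right_distrib matrix_vector_mult_scaleR
          scaleR_add_right)
qed

lemma transpose_adv_matrix:
  assumes "transpose J = - J"
  shows "transpose (adv_matrix J a) = - adv_matrix J a"
proof -
  have "transpose (A + B) = transpose A + transpose B" for A B :: "real^'a^'a"
    by (simp add: transpose_def vec_eq_iff)
  moreover have "- J ** D = - (J ** D)" "D ** - J = - (D ** J)" for D
    by (simp_all add: matrix_matrix_mult_def vec_eq_iff sum_negf)
  ultimately show ?thesis
    by (simp add: adv_matrix_def matrix_transpose_mul transpose_diag_matrix assms)
qed

lemma inner_adv_matrix_skew:
  assumes "transpose J = - J"
  shows "(adv_matrix J a *v b) \<bullet> c = - ((adv_matrix J a *v c) \<bullet> b)"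
proof -
  have "- A *v x = - (A *v x)" for A :: "real^'a^'a" and x
    by (simp add: matrix_vector_mult_def vec_eq_iff sum_negf)
  moreover have "(adv_matrix J a *v b) \<bullet> c = b \<bullet> (transpose (adv_matrix J a) *v c)"
    by (metis dot_lmul_matrix inner_commute transpose_matrix_vector)
  ultimately show ?thesis
    by (simp add: transpose_adv_matrix[OF assms] inner_commute)
qed

lemma norm_adv_matrix_mult_le:
  "norm (adv_matrix J a *v b) \<le> 2 * onorm ((*v) J) * norm a * norm b"
proof -
  have J: "norm (J *v x) \<le> onorm ((*v) J) * norm x" for x
    by (rule onorm[OF matrix_vector_mul_bounded_linear])
  have "norm (diag_matrix a *v (J *v b)) \<le> norm a * (onorm ((*v) J) * norm b)"
    by (rule order_trans[OF norm_diag_matrix_mult_le]) (simp add: J mult_left_mono)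
  moreover have "norm (J *v (diag_matrix a *v b)) \<le> onorm ((*v) J) * (norm a * norm b)"
    by (rule order_trans[OF J])
       (simp add: norm_diag_matrix_mult_le mult_left_mono
          onorm_pos_le[OF matrix_vector_mul_bounded_linear])
  ultimately show ?thesis
    unfolding adv_matrix_mult_vector
    using norm_triangle_ineq[of "diag_matrix a *v (J *v b)" "J *v (diag_matrix a *v b)"]
    by (simp add: mult_ac)
qed

lemma adv_form_eq_inner:
  assumes "subspace V" "c \<in> V"
  shows "adv_form V J a b c = (adv_matrix J a *v b) \<bullet> c"
  by (simp add: adv_form_def adv_op_def inner_orth_projector[OF assms])

lemma trilinear_on_adv_form:
  assumes "subspace V"
  shows "trilinear_on V (adv_form V J)"
proof -
  have "r *\<^sub>R x + s *\<^sub>R y \<in> V" if "x \<in> V" "y \<in> V" for r s x y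
    using assms that by (simp add: subspace_add subspace_mul)
  then show ?thesis
    unfolding trilinear_on_def
    by (simp add: adv_form_eq_inner[OF assms] adv_matrix_mult_lincomb_left inner_add_left
          inner_add_right matrix_vector_right_distrib matrix_vector_mult_scaleR)
qed

theorem proposition1:
  fixes tail head :: "'e::finite \<Rightarrow> 'v::finite"
    and attach :: "'f::finite \<Rightarrow> ('e \<times> bool) list"
    and ip0 :: "real^'v \<Rightarrow> real^'v \<Rightarrow> real"
    and ip2 :: "real^'f \<Rightarrow> real^'f \<Rightarrow> real"
    and J :: "real^'e^'e"
  assumes "oriented_cell_complex2 tail head attach"
    and "is_inner_product ip0"
    and "is_inner_product ip2"
    and "transpose J = - J"
  shows "trilinear_on (div_free tail head ip0) (adv_form (div_free tail head ip0) J) \<and>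
    (\<forall>a \<in> div_free tail head ip0. \<forall>b \<in> div_free tail head ip0. \<forall>c \<in> div_free tail head ip0.
       adv_op (div_free tail head ip0) J a b \<in> div_free tail head ip0 \<and>
       transpose (adv_matrix J a) = - adv_matrix J a \<and>
       adv_form (div_free tail head ip0) J a b c = - adv_form (div_free tail head ip0) J a c b \<and>
       norm (adv_op (div_free tail head ip0) J a b) \<le> 2 * onorm ((*v) J) * norm a * norm b)"
proof -
  let ?V = "div_free tail head ip0"
  have V: "subspace ?V" by (rule subspace_div_free[OF assms(2)])
  have "adv_op ?V J a b \<in> ?V" for a b
    using orth_projector_works[OF V] by (simp add: adv_op_def)
  moreover have "adv_form ?V J a b c = - adv_form ?V J a c b" if "b \<in> ?V" "c \<in> ?V" for a b c
    unfolding adv_form_eq_inner[OF V that(1)] adv_form_eq_inner[OF V that(2)]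
    by (rule inner_adv_matrix_skew[OF assms(4)])
  moreover have "norm (adv_op ?V J a b) \<le> 2 * onorm ((*v) J) * norm a * norm b" for a b
    unfolding adv_op_def
    by (rule order_trans[OF norm_orth_projector_le[OF V] norm_adv_matrix_mult_le])
  ultimately show ?thesis
    using trilinear_on_adv_form[OF V] transpose_adv_matrix[OF assms(4)]
    by (intro conjI ballI)
qed

end
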